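(* Let $G$ be a finite nilpotent group of order $n=p_1^{\lambda_1}p_2^{\lambda_2}\cdots p_r^{\lambda_r}$, where $p_1<p_2<\cdots<p_r$ are primes and each $\lambda_i\ge 1$. Then: (i) $$\frac{n(n-1)}{2}\le W(\mathcal{P}_E(G))\le \frac{2n^2-n-\prod_{i=1}^r\left(p_i^{\lambda_i+1}+p_i^{\lambda_i}-p_i\right)}{2};$$ (ii) $W(\mathcal{P}_E(G))$ attains its lower bound (i.e. equality holds in the first inequality) if and only if $G$ is cyclic; (iii) $W(\mathcal{P}_E(G))$ attains its upper bound (i.e. equality holds in the second inequality) if and only if $|M|=p_1p_2\cdots p_r$ for every $M\in\mathcal{M}(G)$.
   Context: For a finite group $G$, the enhanced power graph $\mathcal{P}_E(G)$ is the simple undirected graph with vertex set $G$ in which two distinct vertices $x,y$ are adjacent if and only if $x,y\in\langle z\rangle$ for some $z\in G$. A maximal cyclic subgroup of $G$ is a cyclic subgroup not properly contained in any cyclic subgroup of $G$; $\mathcal{M}(G)$ is the set of all maximal cyclic subgroups of $G$. For a connected graph $\Gamma$ the Wiener index is $W(\Gamma)=\sum_{x\in V(\Gamma)}\sum_{y\in V(\Gamma)}\frac{d(x,y)}{2}$, where $d(x,y)$ is the number of edges in a shortest path from $x$ to $y$. *)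

theory Defs
  imports
    "HOL-Algebra.Elementary_Groups"
    "HOL-Computational_Algebra.Primes"
    "Graph_Theory.Digraph_Component"
begin

section \<open>Nilpotent groups\<close>

text \<open>The library has no nilpotent groups. The index is shifted: \<open>lower_central_series G 0\<close> is
  the first term of the lower central series, and each next term is \<open>[\<gamma>, G]\<close>. The commutator
  convention is that of \<^const>\<open>derived\<close>.\<close>

primrec lower_central_series :: "('a, 'b) monoid_scheme \<Rightarrow> nat \<Rightarrow> 'a set" where
  "lower_central_series G 0 = carrier G"
| "lower_central_series G (Suc i) =
     generate G (\<Union>h \<in> lower_central_series G i. \<Union>g \<in> carrier G.
       {h \<otimes>\<^bsub>G\<^esub> g \<otimes>\<^bsub>G\<^esub> inv\<^bsub>G\<^esub> h \<otimes>\<^bsub>G\<^esub> inv\<^bsub>G\<^esub> g})"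

definition nilpotent_group :: "('a, 'b) monoid_scheme \<Rightarrow> bool" where
  "nilpotent_group G \<longleftrightarrow> group G \<and> (\<exists>c. lower_central_series G c = {\<one>\<^bsub>G\<^esub>})"

section \<open>Maximal cyclic subgroups\<close>

definition cyclic_subgroups :: "('a, 'b) monoid_scheme \<Rightarrow> 'a set set" where
  "cyclic_subgroups G = {generate G {z} | z. z \<in> carrier G}"

definition maximal_cyclic_subgroups :: "('a, 'b) monoid_scheme \<Rightarrow> 'a set set" where
  "maximal_cyclic_subgroups G =
     {M \<in> cyclic_subgroups G. \<not> (\<exists>C \<in> cyclic_subgroups G. M \<subset> C)}"

section \<open>The enhanced power graph\<close>

text \<open>Following the convention of the graph library, a simple undirected graph is a symmetric
  loop-free digraph, so that every edge is a pair of opposite arcs.\<close>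

definition enhanced_power_graph :: "('a, 'b) monoid_scheme \<Rightarrow> 'a pair_pre_digraph" where
  "enhanced_power_graph G =
     \<lparr> pverts = carrier G,
       parcs = {(x, y). x \<in> carrier G \<and> y \<in> carrier G \<and> x \<noteq> y \<and>
                  (\<exists>z \<in> carrier G. x \<in> generate G {z} \<and> y \<in> generate G {z})} \<rparr>"

section \<open>Distance and Wiener index\<close>

text \<open>A path is given by its list of arcs, so \<open>length\<close> counts edges. The value is meaningful only
  if \<open>y\<close> is reachable from \<open>x\<close>.\<close>

definition graph_dist :: "('a, 'b) pre_digraph \<Rightarrow> 'a \<Rightarrow> 'a \<Rightarrow> nat" where
  "graph_dist \<Gamma> x y = (LEAST k. \<exists>p. pre_digraph.apath \<Gamma> x p y \<and> length p = k)"

definition wiener_index :: "('a, 'b) pre_digraph \<Rightarrow> real" where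
  "wiener_index \<Gamma> = (\<Sum>x \<in> verts \<Gamma>. \<Sum>y \<in> verts \<Gamma>. real (graph_dist \<Gamma> x y) / 2)"

section \<open>The enhanced power graph is a connected simple graph\<close>

lemma pair_graph_enhanced_power_graph:
  assumes "finite (carrier G)"
  shows "pair_graph (enhanced_power_graph G)"
proof -
  have "parcs (enhanced_power_graph G) \<subseteq> carrier G \<times> carrier G"
    by (auto simp: enhanced_power_graph_def)
  then have "finite (parcs (enhanced_power_graph G))"
    using assms finite_subset by blast
  then show ?thesis
    using assms
    by unfold_locales (auto simp: enhanced_power_graph_def symmetric_def sym_def)
qed

lemma connected_enhanced_power_graph:
  assumes "group G" and "finite (carrier G)"
  shows "connected (with_proj (enhanced_power_graph G))"
proof -
  interpret group G by fact
  let ?E = "enhanced_power_graph G"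
  interpret E: pair_graph ?E
    by (rule pair_graph_enhanced_power_graph) fact
  have one: "\<one>\<^bsub>G\<^esub> \<in> pverts ?E"
    by (simp add: enhanced_power_graph_def)
  have to_one: "(x, \<one>\<^bsub>G\<^esub>) \<in> parcs ?E \<and> (\<one>\<^bsub>G\<^esub>, x) \<in> parcs ?E"
    if "x \<in> pverts ?E" "x \<noteq> \<one>\<^bsub>G\<^esub>" for x
    using that by (auto simp: enhanced_power_graph_def intro: generate.intros)
  have reach: "x \<rightarrow>\<^sup>*\<^bsub>with_proj ?E\<^esub> \<one>\<^bsub>G\<^esub> \<and> \<one>\<^bsub>G\<^esub> \<rightarrow>\<^sup>*\<^bsub>with_proj ?E\<^esub> x"
    if "x \<in> pverts ?E" for x
  proof (cases "x = \<one>\<^bsub>G\<^esub>")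
    case True
    then show ?thesis using one by (simp add: E.reachable_refl)
  next
    case False
    then show ?thesis using to_one[OF that False] by (auto intro: E.reachable_adjI)
  qed
  have "mk_symmetric (with_proj ?E) = ?E"
    by (auto simp: mk_symmetric_def enhanced_power_graph_def)
  moreover have "strongly_connected (with_proj ?E)"
    unfolding strongly_connected_def
    using one reach by (auto intro: E.reachable_trans)
  ultimately show ?thesis
    by (simp add: connected_def)
qed

end

theory Submission
  imports Defs "HOL-Algebra.Sylow" "HOL-Algebra.Multiplicative_Group" "HOL-Number_Theory.Cong"
begin

text \<open>
  The identity lies in every cyclic subgroup, so it is adjacent to all other vertices and no
  distance exceeds \<open>2\<close>. If \<open>D\<close> is the number of ordered pairs, diagonal included, that lie in a
  common cyclic subgroup, then \<open>n\<close> pairs have distance \<open>0\<close>, \<open>D - n\<close> have distance \<open>1\<close> and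
  \<open>n\<^sup>2 - D\<close> have distance \<open>2\<close>. Therefore \<open>W = (2 * n\<^sup>2 - n - D) / 2\<close>
  (\<open>wiener_index_enhanced_power_graph\<close>), and the theorem is about the extreme values of \<open>D\<close>.

  The inequality \<open>D \<le> n\<^sup>2\<close> is clear. Equality means that any two elements lie in a common cyclic
  subgroup, so that a maximal cyclic subgroup contains everything
  (\<open>card_cyclic_pairs_upper_bound\<close>).

  For the other bound, nilpotency enters only through the fact that elements of coprime order
  commute (\<open>nilpotent_coprime_commute\<close>). Write \<open>T m\<close> for the set of solutions of \<open>x ^ m = 1\<close>. When
  \<open>a\<close> and \<open>b\<close> are coprime, multiplication is a bijection from \<open>T a \<times> T b\<close> to \<open>T (a * b)\<close> whose
  inverse takes powers. Hence it matches cyclic subgroups too, and both the size of \<open>T m\<close> and the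
  number of pairs of \<open>T m\<close> in a common cyclic subgroup are multiplicative in \<open>m\<close>.
  By Sylow's theorem \<open>T (p ^ l)\<close> has at least \<open>p ^ l\<close> elements
  for each prime power in \<open>n\<close>; the product of these sizes is \<open>n\<close>, so each of them is exact
  (\<open>card_roots_of_one_prime_power\<close>).

  In \<open>T (p ^ l)\<close>, the identity lies in a cyclic subgroup with each of the \<open>p ^ l\<close> elements, and any
  other \<open>x\<close> at least with its own powers, of which there are \<open>p\<close> or more. This gives the factor
  \<open>p ^ l + (p ^ l - 1) * p\<close>, attained exactly when \<open>x ^ p = 1\<close> throughout \<open>T (p ^ l)\<close>
  (\<open>card_cyclic_pairs_prime_power\<close>). Equality in the product forces equality in each factor, that is,
  the exponent of the group divides the product of the primes. Every prime divisor of \<open>n\<close> divides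
  the order of every maximal cyclic subgroup, since otherwise the subgroup could be enlarged by a
  commuting element of that prime order; so the exponent condition says exactly that the maximal
  cyclic subgroups have the stated order (\<open>maximal_cyclic_card_iff\<close>).
\<close>

section \<open>Elements of coprime order in a nilpotent group\<close>

text \<open>Moving \<open>x\<close> past \<open>y\<close> produces one factor \<open>c\<close>, and \<open>c\<close> can be collected in front because it commutes
  with \<open>x\<close>; so moving \<open>x ^ k\<close> past \<open>y\<close> produces \<open>c ^ k\<close>.\<close>

lemma (in group) central_commutator_pow:
  assumes "x \<in> carrier G" "y \<in> carrier G" "c \<in> carrier G"
    and "x \<otimes> y = c \<otimes> y \<otimes> x" and "x \<otimes> c = c \<otimes> x" and "x [^] (a::nat) = \<one>"
  shows "c [^] a = \<one>"
proof -
  have "x [^] k \<otimes> y = c [^] k \<otimes> y \<otimes> x [^] k" for k :: nat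
  proof (induction k)
    case 0
    then show ?case using assms by simp
  next
    case (Suc k)
    have xc: "x \<otimes> c [^] k = c [^] k \<otimes> x"
      using group_commutes_pow[of c x k] assms by simp
    have "x [^] Suc k \<otimes> y = x \<otimes> (x [^] k \<otimes> y)"
      using assms nat_pow_Suc2 by (simp add: m_assoc)
    also have "\<dots> = (x \<otimes> c [^] k) \<otimes> y \<otimes> x [^] k"
      using assms Suc.IH by (simp add: m_assoc)
    also have "\<dots> = c [^] k \<otimes> (x \<otimes> y) \<otimes> x [^] k"
      using assms xc by (simp add: m_assoc)
    also have "\<dots> = (c [^] k \<otimes> c) \<otimes> y \<otimes> (x \<otimes> x [^] k)"
      using assms by (simp add: m_assoc)
    also have "\<dots> = c [^] Suc k \<otimes> y \<otimes> x [^] Suc k"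
      using assms nat_pow_Suc2[of x k] by simp
    finally show ?case .
  qed
  from this[of a] show ?thesis
    using assms by simp
qed

text \<open>The exponents \<open>a\<close> of \<open>x\<close> and \<open>b\<close> of \<open>y\<close> both annihilate \<open>c\<close>: exchanging the roles of \<open>x\<close> and \<open>y\<close>
  replaces \<open>c\<close> by its inverse.\<close>

lemma (in group) coprime_central_commutator:
  assumes xy: "x \<in> carrier G" "y \<in> carrier G"
    and c: "c = x \<otimes> y \<otimes> inv x \<otimes> inv y"
    and comm: "x \<otimes> c = c \<otimes> x" "y \<otimes> c = c \<otimes> y"
    and pow: "x [^] (a::nat) = \<one>" "y [^] (b::nat) = \<one>" and "coprime a b"
  shows "c = \<one>"
proof -
  have cC: "c \<in> carrier G" using xy c by simp
  have eq: "x \<otimes> y = c \<otimes> y \<otimes> x"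
    using xy by (simp add: c m_assoc)
  have "c [^] a = \<one>"
    by (rule central_commutator_pow[of x y]) (use xy cC eq comm pow in auto)
  moreover have "(inv c) [^] b = \<one>"
  proof (rule central_commutator_pow[of y x])
    show "y \<otimes> x = inv c \<otimes> x \<otimes> y"
      using eq xy cC by (simp add: m_assoc inv_solve_left)
    show "y \<otimes> inv c = inv c \<otimes> y"
      using comm(2) xy cC by (metis inv_closed inv_solve_left inv_solve_right m_assoc m_closed)
  qed (use xy cC pow in auto)
  ultimately have "ord c dvd a" "ord c dvd b"
    using cC by (simp_all flip: pow_eq_id add: nat_pow_inv)
  then have "ord c = 1"
    using \<open>coprime a b\<close> by (metis coprime_common_divisor_nat)
  then show ?thesis using cC ord_eq_1 by simp
qed

lemma (in group) lower_central_series_normal: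
  "lower_central_series G i \<lhd> G"
proof (induction i)
  case 0
  show ?case by (simp add: normal_inv_iff subgroup_self)
next
  case (Suc i)
  interpret N: normal "lower_central_series G i" G by fact
  have sub: "lower_central_series G i \<subseteq> carrier G" by (rule N.subset)
  have conj: "u \<otimes> (h \<otimes> g \<otimes> inv h \<otimes> inv g) \<otimes> inv u =
      (u \<otimes> h \<otimes> inv u) \<otimes> (u \<otimes> g \<otimes> inv u) \<otimes> inv (u \<otimes> h \<otimes> inv u) \<otimes> inv (u \<otimes> g \<otimes> inv u)"
    if "h \<in> carrier G" "g \<in> carrier G" "u \<in> carrier G" for h g u
  proof -
    have cancel: "inv u \<otimes> (u \<otimes> z) = z" if "z \<in> carrier G" for z
      using that \<open>u \<in> carrier G\<close> by (simp flip: m_assoc)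
    show ?thesis
      using that by (simp add: m_assoc inv_mult_group cancel)
  qed
  show ?case
    unfolding lower_central_series.simps
  proof (rule normal_generateI)
    show "(\<Union>h \<in> lower_central_series G i. \<Union>g \<in> carrier G. {h \<otimes> g \<otimes> inv h \<otimes> inv g})
            \<subseteq> carrier G"
      using sub by auto
  next
    fix c u
    assume "c \<in> (\<Union>h \<in> lower_central_series G i. \<Union>g \<in> carrier G. {h \<otimes> g \<otimes> inv h \<otimes> inv g})"
      and u: "u \<in> carrier G"
    then obtain h g where h: "h \<in> lower_central_series G i" and g: "g \<in> carrier G"
      and c: "c = h \<otimes> g \<otimes> inv h \<otimes> inv g" by auto
    have "u \<otimes> h \<otimes> inv u \<in> lower_central_series G i"
      using N.inv_op_closed2 h u by blast
    moreover have "u \<otimes> g \<otimes> inv u \<in> carrier G" using u g by simp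
    ultimately show "u \<otimes> c \<otimes> inv u \<in>
        (\<Union>h \<in> lower_central_series G i. \<Union>g \<in> carrier G. {h \<otimes> g \<otimes> inv h \<otimes> inv g})"
      using conj[of h g u] h sub g u c by blast
  qed
qed

text \<open>Suppose that the commutator \<open>c\<close> lies in term \<open>i\<close> of the series. Modulo term \<open>i + 1\<close> it is then
  central, and \<open>coprime_central_commutator\<close>, applied in the quotient, shows that it is trivial there.
  So \<open>c\<close> lies in term \<open>i + 1\<close>, and descends all the way to the trivial subgroup.\<close>

lemma (in group) coprime_commutator_in_lower_central_series:
  assumes xy: "x \<in> carrier G" "y \<in> carrier G"
    and pow: "x [^] (a::nat) = \<one>" "y [^] (b::nat) = \<one>" and cop: "coprime a b"
  shows "x \<otimes> y \<otimes> inv x \<otimes> inv y \<in> lower_central_series G i"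
proof (induction i)
  case 0
  show ?case using xy by simp
next
  case (Suc i)
  define c where "c = x \<otimes> y \<otimes> inv x \<otimes> inv y"
  define N where "N = lower_central_series G (Suc i)"
  define Q where "Q = G Mod N"
  define q where "q = (\<lambda>g. N #> g)"
  interpret N: normal N G unfolding N_def by (rule lower_central_series_normal)
  interpret Q: group Q unfolding Q_def by (rule N.factorgroup_is_group)
  interpret q: group_hom G Q q
    unfolding Q_def q_def
    by (intro group_hom.intro group_hom_axioms.intro is_group N.factorgroup_is_group
        N.r_coset_hom_Mod)
  have c: "c \<in> carrier G" using xy by (simp add: c_def)
  have q_one: "q g = \<one>\<^bsub>Q\<^esub> \<longleftrightarrow> g \<in> N" if "g \<in> carrier G" for g
    using coset_join1[OF _ that N.subgroup_axioms] coset_join2[OF that N.subgroup_axioms]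
    by (auto simp: Q_def q_def FactGroup_def)
  \<comment> \<open>Commutators with \<open>c\<close> lie in \<open>N\<close>, so the image of \<open>c\<close> is central in the quotient.\<close>
  have comm: "q g \<otimes>\<^bsub>Q\<^esub> q c = q c \<otimes>\<^bsub>Q\<^esub> q g" if g: "g \<in> carrier G" for g
  proof -
    have "c \<otimes> g \<otimes> inv c \<otimes> inv g \<in> N"
      unfolding N_def lower_central_series.simps
      by (rule generate.incl) (use Suc.IH g in \<open>auto simp: c_def\<close>)
    then have "q (c \<otimes> g \<otimes> inv c \<otimes> inv g) = \<one>\<^bsub>Q\<^esub>"
      using c g by (subst q_one) simp_all
    then have "q c \<otimes>\<^bsub>Q\<^esub> q g \<otimes>\<^bsub>Q\<^esub> inv\<^bsub>Q\<^esub> q c \<otimes>\<^bsub>Q\<^esub> inv\<^bsub>Q\<^esub> q g = \<one>\<^bsub>Q\<^esub>"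
      using c g by simp
    then have "q c \<otimes>\<^bsub>Q\<^esub> q g \<otimes>\<^bsub>Q\<^esub> inv\<^bsub>Q\<^esub> q c = q g"
      using c g by (metis Q.inv_solve_right' Q.l_one Q.m_closed Q.inv_closed Q.one_closed q.hom_closed)
    then show ?thesis
      using c g by (metis Q.inv_solve_right' Q.m_closed q.hom_closed)
  qed
  have "q c = \<one>\<^bsub>Q\<^esub>"
  proof (rule Q.coprime_central_commutator[of "q x" "q y" "q c" a b])
    show "q c = q x \<otimes>\<^bsub>Q\<^esub> q y \<otimes>\<^bsub>Q\<^esub> inv\<^bsub>Q\<^esub> q x \<otimes>\<^bsub>Q\<^esub> inv\<^bsub>Q\<^esub> q y"
      using xy by (simp add: c_def)
    show "q x [^]\<^bsub>Q\<^esub> a = \<one>\<^bsub>Q\<^esub>" "q y [^]\<^bsub>Q\<^esub> b = \<one>\<^bsub>Q\<^esub>"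
      using xy pow by (simp_all flip: q.hom_nat_pow)
  qed (use xy comm cop in auto)
  then show ?case
    using q_one c by (simp only: c_def N_def)
qed

lemma nilpotent_coprime_commute:
  fixes G (structure)
  assumes "nilpotent_group G" "x \<in> carrier G" "y \<in> carrier G"
    and "x [^] (a::nat) = \<one>" "y [^] (b::nat) = \<one>" "coprime a b"
  shows "x \<otimes> y = y \<otimes> x"
proof -
  interpret group G using assms(1) by (simp add: nilpotent_group_def)
  obtain k where "lower_central_series G k = {\<one>}"
    using assms(1) by (auto simp: nilpotent_group_def)
  then have "x \<otimes> y \<otimes> inv x \<otimes> inv y = \<one>"
    using coprime_commutator_in_lower_central_series[OF assms(2-6), of k] by simp
  then show ?thesis
    using assms(2,3) by (metis inv_closed inv_solve_right' l_one m_closed one_closed)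
qed

section \<open>Decomposition into coprime parts\<close>

definition roots_of_one :: "('a, 'b) monoid_scheme \<Rightarrow> nat \<Rightarrow> 'a set" where
  "roots_of_one G m = {x \<in> carrier G. x [^]\<^bsub>G\<^esub> m = \<one>\<^bsub>G\<^esub>}"

text \<open>With \<open>A\<close> the whole group this is the adjacency relation of the enhanced power graph together with
  the diagonal. The common cyclic subgroup is generated inside \<open>A\<close>, so that the count for
  \<open>roots_of_one G (p ^ l)\<close> is internal to the \<open>p\<close>-part.\<close>

definition cyclic_pairs :: "('a, 'b) monoid_scheme \<Rightarrow> 'a set \<Rightarrow> ('a \<times> 'a) set" where
  "cyclic_pairs G A = (\<Union>z \<in> A. generate G {z} \<times> generate G {z})"

text \<open>The one consequence of nilpotency on which all later arguments rest. Among finite groups it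
  characterises the nilpotent ones.\<close>

locale finite_coprime_commuting_group = group +
  assumes finite_carrier: "finite (carrier G)"
    and commute_if_coprime: "\<lbrakk>x \<in> carrier G; y \<in> carrier G; x [^] (a::nat) = \<one>; y [^] (b::nat) = \<one>;
          coprime a b\<rbrakk> \<Longrightarrow> x \<otimes> y = y \<otimes> x"

lemma (in group) mem_generate_singleton_iff:
  assumes "finite (carrier G)" "z \<in> carrier G"
  shows "x \<in> generate G {z} \<longleftrightarrow> (\<exists>k::nat. x = z [^] k)"
  using generate_pow_on_finite_carrier[OF assms] by auto

lemma (in group) generate_pow_subset:
  assumes "finite (carrier G)" "z \<in> carrier G"
  shows "generate G {z [^] (k::nat)} \<subseteq> generate G {z}"
  using assms by (auto simp: mem_generate_singleton_iff nat_pow_pow)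

lemma (in group) generate_singleton_mono:
  assumes "finite (carrier G)" "z \<in> carrier G" "x \<in> generate G {z}"
  shows "generate G {x} \<subseteq> generate G {z}"
  using assms generate_pow_subset by (auto simp: mem_generate_singleton_iff)

lemma (in group) generate_roots_of_one:
  assumes "finite (carrier G)" "z \<in> roots_of_one G m"
  shows "generate G {z} \<subseteq> roots_of_one G m"
proof
  fix x assume "x \<in> generate G {z}"
  then obtain k :: nat where k: "x = z [^] k"
    using assms by (auto simp: mem_generate_singleton_iff roots_of_one_def)
  have z: "z \<in> carrier G" "z [^] m = \<one>" using assms by (auto simp: roots_of_one_def)
  have "x [^] m = (z [^] m) [^] k"
    unfolding k nat_pow_pow[OF z(1)] by (simp add: mult.commute)
  then show "x \<in> roots_of_one G m"
    using z k by (simp add: roots_of_one_def)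
qed

lemma (in group) pow_cong_roots_of_one:
  assumes "u \<in> roots_of_one G a" "[k = k'] (mod a)"
  shows "u [^] k = u [^] k'"
proof -
  have "u [^] j = u [^] (j mod a)" for j
  proof -
    have u: "u \<in> carrier G" using assms by (simp add: roots_of_one_def)
    have "u [^] j = u [^] (a * (j div a) + j mod a)" by simp
    also have "\<dots> = (u [^] a) [^] (j div a) \<otimes> u [^] (j mod a)"
      unfolding nat_pow_pow[OF u] nat_pow_mult[OF u] ..
    also have "\<dots> = u [^] (j mod a)"
      using assms by (simp add: roots_of_one_def)
    finally show ?thesis .
  qed
  then show ?thesis
    using assms(2) by (metis cong_def)
qed

context finite_coprime_commuting_group
begin

text \<open>With \<open>s \<equiv> 1\<close> modulo \<open>a\<close>, \<open>s \<equiv> 0\<close> modulo \<open>b\<close>, and \<open>t\<close> the other way round, the two components of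
  an element are its powers with exponents \<open>s\<close> and \<open>t\<close>. That the projections are power maps is what
  makes them respect cyclic subgroups.\<close>

lemma coprime_projections:
  assumes "coprime a b"
  obtains s t :: nat where
    "\<And>u v. \<lbrakk>u \<in> roots_of_one G a; v \<in> roots_of_one G b\<rbrakk> \<Longrightarrow> (u \<otimes> v) [^] s = u \<and> (u \<otimes> v) [^] t = v"
    "\<And>x. x \<in> roots_of_one G (a * b) \<Longrightarrow>
        x [^] s \<in> roots_of_one G a \<and> x [^] t \<in> roots_of_one G b \<and> x [^] s \<otimes> x [^] t = x"
proof -
  obtain s where s: "[s = 1] (mod a)" "[s = 0] (mod b)"
    using binary_chinese_remainder_nat[OF assms] by blast
  obtain t where t: "[t = 0] (mod a)" "[t = 1] (mod b)"
    using binary_chinese_remainder_nat[OF assms] by blast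
  show thesis
  proof (rule that)
    fix u v assume uv: "u \<in> roots_of_one G a" "v \<in> roots_of_one G b"
    have C: "u \<in> carrier G" "v \<in> carrier G" using uv by (auto simp: roots_of_one_def)
    have "u \<otimes> v = v \<otimes> u"
      using commute_if_coprime[of u v a b] uv assms by (simp add: roots_of_one_def)
    then have pow: "(u \<otimes> v) [^] k = u [^] k \<otimes> v [^] k" for k :: nat
      using pow_mult_distrib C by simp
    show "(u \<otimes> v) [^] s = u \<and> (u \<otimes> v) [^] t = v"
      unfolding pow
      using pow_cong_roots_of_one[OF uv(1) s(1)] pow_cong_roots_of_one[OF uv(2) s(2)]
        pow_cong_roots_of_one[OF uv(1) t(1)] pow_cong_roots_of_one[OF uv(2) t(2)] C
      by simp
  next
    fix x assume x: "x \<in> roots_of_one G (a * b)"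
    have C: "x \<in> carrier G" using x by (auto simp: roots_of_one_def)
    have "[s + t = 1] (mod a)" "[s + t = 1] (mod b)"
      using cong_add[OF s(1) t(1)] cong_add[OF s(2) t(2)] by simp_all
    then have "[s + t = 1] (mod a * b)"
      using assms coprime_cong_mult_nat by blast
    from pow_cong_roots_of_one[OF x this] have "x [^] s \<otimes> x [^] t = x"
      using C by (simp add: nat_pow_mult)
    moreover have "[s * a = 0] (mod a * b)" "[t * b = 0] (mod a * b)"
      using s t by (auto simp: cong_0_iff mult.commute)
    then have "x [^] (s * a) = \<one>" "x [^] (t * b) = \<one>"
      using pow_cong_roots_of_one[OF x] nat_pow_0 by metis+
    ultimately show "x [^] s \<in> roots_of_one G a \<and> x [^] t \<in> roots_of_one G b \<and> x [^] s \<otimes> x [^] t = x"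
      using C by (simp add: roots_of_one_def nat_pow_pow)
  qed
qed

lemma mult_roots_of_one:
  assumes "coprime a b" "u \<in> roots_of_one G a" "v \<in> roots_of_one G b"
  shows "u \<otimes> v \<in> roots_of_one G (a * b)"
proof -
  have C: "u \<in> carrier G" "v \<in> carrier G" using assms by (auto simp: roots_of_one_def)
  have "u \<otimes> v = v \<otimes> u"
    using commute_if_coprime[of u v a b] assms by (simp add: roots_of_one_def)
  then have "(u \<otimes> v) [^] (a * b) = u [^] (a * b) \<otimes> v [^] (b * a)"
    using pow_mult_distrib C by (simp add: mult.commute)
  also have "\<dots> = \<one>"
    using assms C by (simp flip: nat_pow_pow add: roots_of_one_def)
  finally show ?thesis using C by (simp add: roots_of_one_def)
qed

lemma finite_roots_of_one: "finite (roots_of_one G m)"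
  using finite_carrier by (simp add: roots_of_one_def)

lemma card_roots_of_one_mult:
  assumes "coprime a b"
  shows "card (roots_of_one G (a * b)) = card (roots_of_one G a) * card (roots_of_one G b)"
proof -
  obtain s t :: nat where st:
    "\<And>u v. \<lbrakk>u \<in> roots_of_one G a; v \<in> roots_of_one G b\<rbrakk> \<Longrightarrow> (u \<otimes> v) [^] s = u \<and> (u \<otimes> v) [^] t = v"
    "\<And>x. x \<in> roots_of_one G (a * b) \<Longrightarrow>
        x [^] s \<in> roots_of_one G a \<and> x [^] t \<in> roots_of_one G b \<and> x [^] s \<otimes> x [^] t = x"
    using coprime_projections[OF assms] by blast
  have "bij_betw (\<lambda>(u, v). u \<otimes> v) (roots_of_one G a \<times> roots_of_one G b) (roots_of_one G (a * b))"
    by (rule bij_betw_byWitness[where f' = "\<lambda>x. (x [^] s, x [^] t)"])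
      (use st mult_roots_of_one[OF assms] in auto)
  then show ?thesis
    by (metis bij_betw_same_card card_cartesian_product)
qed

text \<open>If \<open>z\<close> and \<open>z'\<close> have coprime exponents, then \<open>z \<otimes> z'\<close> generates both of them. So two pairs, one in
  \<open>\<langle>z\<rangle>\<close> and one in \<open>\<langle>z'\<rangle>\<close>, multiply to a pair in \<open>\<langle>z \<otimes> z'\<rangle>\<close>; conversely the power maps send a pair
  in \<open>\<langle>z\<rangle>\<close> to a pair in the subgroup generated by the same power of \<open>z\<close>.\<close>

lemma card_cyclic_pairs_mult:
  assumes "coprime a b"
  shows "card (cyclic_pairs G (roots_of_one G (a * b))) =
    card (cyclic_pairs G (roots_of_one G a)) * card (cyclic_pairs G (roots_of_one G b))"
proof -
  obtain s t :: nat where st1: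
    "\<And>u v. \<lbrakk>u \<in> roots_of_one G a; v \<in> roots_of_one G b\<rbrakk> \<Longrightarrow> (u \<otimes> v) [^] s = u \<and> (u \<otimes> v) [^] t = v"
    and st2: "\<And>x. x \<in> roots_of_one G (a * b) \<Longrightarrow>
        x [^] s \<in> roots_of_one G a \<and> x [^] t \<in> roots_of_one G b \<and> x [^] s \<otimes> x [^] t = x"
    using coprime_projections[OF assms] by blast
  let ?P = "\<lambda>m. cyclic_pairs G (roots_of_one G m)"
  have C: "x \<in> carrier G" if "x \<in> roots_of_one G m" for x m
    using that by (simp add: roots_of_one_def)
  have P: "x \<in> roots_of_one G m \<and> y \<in> roots_of_one G m" if "(x, y) \<in> ?P m" for x y m
    using that generate_roots_of_one[OF finite_carrier] by (auto simp: cyclic_pairs_def)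
  let ?f = "\<lambda>((x, y), (x', y')). (x \<otimes> x', y \<otimes> y')"
  let ?g = "\<lambda>(x, y). ((x [^] s, y [^] s), (x [^] t, y [^] t))"
  have f: "(x \<otimes> x', y \<otimes> y') \<in> ?P (a * b)"
    if xy: "(x, y) \<in> ?P a" and xy': "(x', y') \<in> ?P b" for x y x' y'
  proof -
    obtain z where z: "z \<in> roots_of_one G a" "x \<in> generate G {z}" "y \<in> generate G {z}"
      using xy by (auto simp: cyclic_pairs_def)
    obtain z' where z': "z' \<in> roots_of_one G b" "x' \<in> generate G {z'}" "y' \<in> generate G {z'}"
      using xy' by (auto simp: cyclic_pairs_def)
    let ?w = "z \<otimes> z'"
    have w: "?w \<in> roots_of_one G (a * b)" using mult_roots_of_one[OF assms z(1) z'(1)] .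
    have "generate G {z} \<subseteq> generate G {?w}" "generate G {z'} \<subseteq> generate G {?w}"
      using st1[OF z(1) z'(1)] generate_pow_subset[OF finite_carrier C[OF w]] by metis+
    moreover have "subgroup (generate G {?w}) G"
      using C[OF w] by (intro generate_is_subgroup) auto
    ultimately have "x \<otimes> x' \<in> generate G {?w}" "y \<otimes> y' \<in> generate G {?w}"
      using z z' by (meson subgroup.m_closed subsetD)+
    then show ?thesis using w by (auto simp: cyclic_pairs_def)
  qed
  have g: "(x [^] k, y [^] k) \<in> ?P m"
    if xy: "(x, y) \<in> ?P (a * b)"
      and km: "\<And>x. x \<in> roots_of_one G (a * b) \<Longrightarrow> x [^] k \<in> roots_of_one G m" for x y m and k :: nat
  proof -
    obtain z where z: "z \<in> roots_of_one G (a * b)" "x \<in> generate G {z}" "y \<in> generate G {z}"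
      using xy by (auto simp: cyclic_pairs_def)
    have *: "w [^] k \<in> generate G {z [^] k}" if w: "w \<in> generate G {z}" for w
    proof -
      obtain j :: nat where "w = z [^] j"
        using w mem_generate_singleton_iff[OF finite_carrier C[OF z(1)]] by auto
      then have "w [^] k = (z [^] k) [^] j"
        using C[OF z(1)] by (simp add: nat_pow_pow mult.commute)
      then show ?thesis
        using mem_generate_singleton_iff[OF finite_carrier, of "z [^] k"] C[OF z(1)] by auto
    qed
    show ?thesis
      using km[OF z(1)] *[OF z(2)] *[OF z(3)] by (auto simp: cyclic_pairs_def)
  qed
  have "bij_betw ?f (?P a \<times> ?P b) (?P (a * b))"
  proof (rule bij_betw_byWitness[where f' = ?g])
    show "\<forall>q \<in> ?P a \<times> ?P b. ?g (?f q) = q"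
      using st1 P by fastforce
    show "\<forall>q \<in> ?P (a * b). ?f (?g q) = q"
      using st2 P by fastforce
    show "?f ` (?P a \<times> ?P b) \<subseteq> ?P (a * b)"
      using f by auto
    show "?g ` ?P (a * b) \<subseteq> ?P a \<times> ?P b"
      using g[where k = s] g[where k = t] st2 by auto
  qed
  then show ?thesis
    by (metis bij_betw_same_card card_cartesian_product)
qed

text \<open>Exponent conditions can be tested on coprime components. This turns the exponent condition on the
  whole group into one condition for each prime.\<close>

lemma roots_of_one_subset_mult_iff:
  assumes cop: "coprime a b" and ca: "c dvd a" and db: "d dvd b"
  shows "roots_of_one G (a * b) \<subseteq> roots_of_one G (c * d) \<longleftrightarrow>
    roots_of_one G a \<subseteq> roots_of_one G c \<and> roots_of_one G b \<subseteq> roots_of_one G d"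
proof -
  have sub: "roots_of_one G a' \<subseteq> roots_of_one G c'"
    if "roots_of_one G (a' * b') \<subseteq> roots_of_one G (c' * d')" "coprime a' b'" "d' dvd b'"
    for a' b' c' d'
  proof
    fix u assume u: "u \<in> roots_of_one G a'"
    then have C: "u \<in> carrier G" and "ord u dvd a'"
      by (auto simp: roots_of_one_def pow_eq_id)
    then have "coprime (ord u) d'"
      using that(2,3) coprime_divisors by blast
    moreover have "ord u dvd c' * d'"
      using that(1) C \<open>ord u dvd a'\<close> by (auto simp: roots_of_one_def pow_eq_id)
    ultimately show "u \<in> roots_of_one G c'"
      using C by (simp add: roots_of_one_def pow_eq_id coprime_dvd_mult_left_iff)
  qed
  have "coprime c d" using assms coprime_divisors by blast
  then have "x \<in> roots_of_one G (c * d)"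
    if sub: "roots_of_one G a \<subseteq> roots_of_one G c" "roots_of_one G b \<subseteq> roots_of_one G d"
      and x: "x \<in> roots_of_one G (a * b)" for x
  proof -
    obtain s t :: nat where
      "x [^] s \<in> roots_of_one G a \<and> x [^] t \<in> roots_of_one G b \<and> x [^] s \<otimes> x [^] t = x"
      by (rule coprime_projections[OF cop]) (use x in blast)
    then show ?thesis
      using mult_roots_of_one[OF \<open>coprime c d\<close>] sub by (metis subsetD)
  qed
  moreover have "roots_of_one G a \<subseteq> roots_of_one G c" "roots_of_one G b \<subseteq> roots_of_one G d"
    if "roots_of_one G (a * b) \<subseteq> roots_of_one G (c * d)"
    using sub[of a b c d] sub[of b a d c] that assms
    by (simp_all add: mult.commute[of b a] mult.commute[of d c] coprime_commute[of b a])
  ultimately show ?thesis by blast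
qed

end


section \<open>Prime power torsion\<close>

lemma (in group) prime_power_le_card_roots_of_one:
  assumes "finite (carrier G)" "prime p" "p ^ k dvd order G"
  shows "p ^ k \<le> card (roots_of_one G (p ^ k))"
proof -
  obtain m where "order G = p ^ k * m" using assms(3) by blast
  then obtain H where H: "subgroup H G" "card H = p ^ k"
    using sylow_thm[OF assms(2) group_axioms _ assms(1)] by blast
  interpret H: group "G\<lparr>carrier := H\<rparr>"
    using H(1) by (rule subgroup_imp_group)
  have "H \<subseteq> roots_of_one G (p ^ k)"
  proof
    fix h assume h: "h \<in> H"
    then have "h [^]\<^bsub>G\<lparr>carrier := H\<rparr>\<^esub> order (G\<lparr>carrier := H\<rparr>) = \<one>\<^bsub>G\<lparr>carrier := H\<rparr>\<^esub>"
      by (intro H.pow_order_eq_1) simp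
    then have "h [^] card H = \<one>"
      by (simp add: order_def flip: nat_pow_consistent)
    then show "h \<in> roots_of_one G (p ^ k)"
      using h H subgroup.subset by (auto simp: roots_of_one_def)
  qed
  moreover have "finite (roots_of_one G (p ^ k))"
    using assms(1) by (simp add: roots_of_one_def)
  ultimately show ?thesis
    using H(2) card_mono by metis
qed

text \<open>The pairs are counted by their first entry. The identity is paired with all of \<open>T\<close>. Any other \<open>x\<close>
  is paired at least with its powers, and \<open>ord x\<close> is a positive multiple of \<open>p\<close>. If every element has
  exponent \<open>p\<close>, then a cyclic subgroup that contains \<open>x\<close> has order \<open>p\<close> and is already generated by
  \<open>x\<close>, so \<open>x\<close> is paired with nothing else.\<close>

lemma (in group) card_cyclic_pairs_prime_power:
  fixes p l :: nat
  defines "T \<equiv> roots_of_one G (p ^ l)"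
  assumes fin: "finite (carrier G)" and p: "prime p"
  shows "card T + (card T - 1) * p \<le> card (cyclic_pairs G T)"
    and "card (cyclic_pairs G T) = card T + (card T - 1) * p \<longleftrightarrow> T \<subseteq> roots_of_one G p"
proof -
  define N where "N = (\<lambda>x. {y. (x, y) \<in> cyclic_pairs G T})"
  have T: "finite T" "\<one> \<in> T" "T \<subseteq> carrier G"
    using fin by (auto simp: T_def roots_of_one_def)
  have gen: "generate G {z} \<subseteq> T" if "z \<in> T" for z
    using generate_roots_of_one[OF fin] that by (simp add: T_def)
  have self: "z \<in> generate G {z}" for z by (simp add: generate.incl)
  have NT: "N x \<subseteq> T" for x using gen by (auto simp: N_def cyclic_pairs_def)
  have finN: "finite (N x)" for x using NT T(1) finite_subset by blast
  have "cyclic_pairs G T = Sigma T N"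
    using gen by (auto simp: N_def cyclic_pairs_def)
  then have "card (cyclic_pairs G T) = (\<Sum>x \<in> T. card (N x))"
    using T(1) finN by (simp add: card_SigmaI)
  also have "\<dots> = card (N \<one>) + (\<Sum>x \<in> T - {\<one>}. card (N x))"
    using T by (intro sum.remove)
  also have "N \<one> = T"
    using NT self generate.one by (fastforce simp: N_def cyclic_pairs_def)
  finally have card: "card (cyclic_pairs G T) = card T + (\<Sum>x \<in> T - {\<one>}. card (N x))" .
  have ord_dvd: "p dvd ord x" if "x \<in> T - {\<one>}" for x
  proof -
    have "ord x dvd p ^ l" "ord x \<noteq> 1"
      using that T ord_eq_1 by (auto simp: T_def roots_of_one_def simp flip: pow_eq_id)
    then show ?thesis
      using p by (metis divides_primepow_nat dvd_triv_left power_0 power_eq_if)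
  qed
  have gen_N: "generate G {x} \<subseteq> N x" if "x \<in> T" for x
    using that self by (auto simp: N_def cyclic_pairs_def)
  have ord_le: "ord x \<le> card (N x)" if "x \<in> T" for x
    using card_mono[OF finN gen_N[OF that]] that T generate_pow_card by auto
  have ord_pos: "0 < ord x" if "x \<in> T" for x
    using ord_ge_1[OF fin, of x] that T by auto
  have le: "p \<le> card (N x)" if "x \<in> T - {\<one>}" for x
    using dvd_imp_le[OF ord_dvd[OF that]] ord_pos[of x] ord_le[of x] that by force
  have sum_const: "(\<Sum>x \<in> T - {\<one>}. p) = (card T - 1) * p"
    using T by simp
  show "card T + (card T - 1) * p \<le> card (cyclic_pairs G T)"
    unfolding card sum_const[symmetric] using le by (intro add_left_mono sum_mono)
  have "card (cyclic_pairs G T) = card T + (card T - 1) * p \<longleftrightarrow>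
      (\<forall>x \<in> T - {\<one>}. card (N x) = p)"
  proof
    assume "card (cyclic_pairs G T) = card T + (card T - 1) * p"
    then have eq: "(\<Sum>x \<in> T - {\<one>}. p) = (\<Sum>x \<in> T - {\<one>}. card (N x))"
      using card sum_const by simp
    show "\<forall>x \<in> T - {\<one>}. card (N x) = p"
      using sum_mono_inv[OF eq le] T(1) by auto
  next
    assume "\<forall>x \<in> T - {\<one>}. card (N x) = p"
    then have "(\<Sum>x \<in> T - {\<one>}. card (N x)) = (\<Sum>x \<in> T - {\<one>}. p)"
      by (intro sum.cong) auto
    then show "card (cyclic_pairs G T) = card T + (card T - 1) * p"
      unfolding card sum_const by simp
  qed
  also have "\<dots> \<longleftrightarrow> T \<subseteq> roots_of_one G p"
  proof
    assume eq: "\<forall>x \<in> T - {\<one>}. card (N x) = p"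
    show "T \<subseteq> roots_of_one G p"
    proof
      fix x assume x: "x \<in> T"
      show "x \<in> roots_of_one G p"
      proof (cases "x = \<one>")
        case False
        then have "ord x \<le> p" using x ord_le eq by fastforce
        then have "ord x = p"
          using x False dvd_imp_le[OF ord_dvd ord_pos] by fastforce
        then show ?thesis using x T pow_ord_eq_1 by (auto simp: roots_of_one_def)
      qed (simp add: roots_of_one_def)
    qed
  next
    assume exponent: "T \<subseteq> roots_of_one G p"
    have "card (N x) = p" if x: "x \<in> T - {\<one>}" for x
    proof -
      have ord: "ord z = p" if "z \<in> T - {\<one>}" for z
      proof (rule dvd_antisym)
        show "ord z dvd p"
          using exponent that by (auto simp: roots_of_one_def pow_eq_id)
      qed (rule ord_dvd[OF that])
      have "N x \<subseteq> generate G {x}"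
      proof
        fix y assume "y \<in> N x"
        then obtain z where z: "z \<in> T" "x \<in> generate G {z}" "y \<in> generate G {z}"
          by (auto simp: N_def cyclic_pairs_def)
        have "z \<noteq> \<one>" using z(2) x generate_one by auto
        then have cards: "card (generate G {z}) = p" "card (generate G {x}) = p"
          using ord[of z] ord[of x] x z(1) T generate_pow_card by auto
        have "finite (generate G {z})" using gen[OF z(1)] T(1) finite_subset by blast
        moreover have "generate G {x} \<subseteq> generate G {z}"
          using generate_singleton_mono[OF fin _ z(2)] z(1) T by blast
        ultimately have "generate G {x} = generate G {z}"
          using cards card_subset_eq by metis
        then show "y \<in> generate G {x}" using z(3) by simp
      qed
      then have "N x = generate G {x}" using gen_N x by blast
      then show ?thesis using ord[OF x] x T generate_pow_card by auto
    qed
    then show "\<forall>x \<in> T - {\<one>}. card (N x) = p" by blast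
  qed
  finally show "card (cyclic_pairs G T) = card T + (card T - 1) * p \<longleftrightarrow> T \<subseteq> roots_of_one G p" .
qed

section \<open>Products over coprime prime powers\<close>

lemma prod_coprime_multiplicative:
  fixes f :: "nat \<Rightarrow> nat"
  assumes "finite I" and "\<And>i j. \<lbrakk>i \<in> I; j \<in> I; i \<noteq> j\<rbrakk> \<Longrightarrow> coprime (q i) (q j)"
    and "f 1 = 1" and "\<And>a b. coprime a b \<Longrightarrow> f (a * b) = f a * f b"
  shows "f (\<Prod>i \<in> I. q i) = (\<Prod>i \<in> I. f (q i))"
  using assms(1,2)
proof (induction I rule: finite_induct)
  case (insert j I)
  then have "coprime (q j) (\<Prod>i \<in> I. q i)"
    by (intro prod_coprime_right) auto
  then show ?case using insert assms(4) by auto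
qed (use assms(3) in simp)

lemma prod_eq_imp_factors_eq:
  fixes f g :: "'i \<Rightarrow> nat"
  assumes "finite I" and le: "\<And>i. i \<in> I \<Longrightarrow> f i \<le> g i" and pos: "\<And>i. i \<in> I \<Longrightarrow> 0 < f i"
    and eq: "prod f I = prod g I" and j: "j \<in> I"
  shows "f j = g j"
proof -
  have "prod f (I - {j}) \<le> prod g (I - {j})" using le by (intro prod_mono) auto
  moreover have "0 < prod f (I - {j})" using pos by (intro prod_pos) auto
  moreover have "f j * prod f (I - {j}) = g j * prod g (I - {j})"
    using eq prod.remove[OF assms(1) j] by metis
  ultimately have "\<not> f j < g j"
    by (metis mult_less_le_imp_less less_irrefl zero_le)
  then show ?thesis using le[OF j] by simp
qed

context finite_coprime_commuting_group
begin

lemma roots_of_one_subset_prod_iff: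
  assumes "finite I" and "\<And>i j. \<lbrakk>i \<in> I; j \<in> I; i \<noteq> j\<rbrakk> \<Longrightarrow> coprime (q i) (q j)"
    and "\<And>i. i \<in> I \<Longrightarrow> p i dvd q i"
  shows "roots_of_one G (\<Prod>i \<in> I. q i) \<subseteq> roots_of_one G (\<Prod>i \<in> I. p i) \<longleftrightarrow>
    (\<forall>i \<in> I. roots_of_one G (q i) \<subseteq> roots_of_one G (p i))"
  using assms
proof (induction I rule: finite_induct)
  case (insert j I)
  have "coprime (q j) (\<Prod>i \<in> I. q i)"
    using insert by (intro prod_coprime_right) auto
  moreover have "(\<Prod>i \<in> I. p i) dvd (\<Prod>i \<in> I. q i)"
    using insert by (intro prod_dvd_prod) auto
  ultimately show ?case
    using insert roots_of_one_subset_mult_iff[of "q j" "\<Prod>i \<in> I. q i" "p j" "\<Prod>i \<in> I. p i"]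
    by simp
qed simp

lemma roots_of_one_1: "roots_of_one G 1 = {\<one>}"
  by (auto simp: roots_of_one_def)

lemma card_cyclic_pairs_one: "card (cyclic_pairs G (roots_of_one G 1)) = 1"
  by (simp only: roots_of_one_1 cyclic_pairs_def) (simp add: generate_one)

text \<open>Sylow's theorem bounds each factor of \<open>order G = (\<Prod>i \<in> I. card (roots_of_one G (p i ^ l i)))\<close>
  from below by \<open>p i ^ l i\<close>, and the product of these bounds is the order as well.\<close>

lemma card_roots_of_one_prime_power:
  assumes I: "finite I" and cop: "\<And>i j. \<lbrakk>i \<in> I; j \<in> I; i \<noteq> j\<rbrakk> \<Longrightarrow> coprime (p i ^ l i) (p j ^ l j)"
    and prime: "\<And>i. i \<in> I \<Longrightarrow> prime (p i)"
    and order: "order G = (\<Prod>i \<in> I. p i ^ l i)" and j: "j \<in> I"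
  shows "card (roots_of_one G (p j ^ l j)) = p j ^ l j"
proof (rule prod_eq_imp_factors_eq[OF I _ _ _ j, symmetric])
  have "(\<Prod>i \<in> I. card (roots_of_one G (p i ^ l i))) = card (roots_of_one G (order G))"
    unfolding order
    by (rule prod_coprime_multiplicative[OF I cop, symmetric])
      (auto simp: card_roots_of_one_mult simp del: One_nat_def simp: roots_of_one_1)
  also have "roots_of_one G (order G) = carrier G"
    using pow_order_eq_1 by (auto simp: roots_of_one_def)
  finally show "(\<Prod>i \<in> I. p i ^ l i) = (\<Prod>i \<in> I. card (roots_of_one G (p i ^ l i)))"
    using order by (simp add: order_def)
  show "p i ^ l i \<le> card (roots_of_one G (p i ^ l i))" if "i \<in> I" for i
    using that by (intro prime_power_le_card_roots_of_one finite_carrier prime)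
      (auto simp: order I)
  show "0 < p i ^ l i" if "i \<in> I" for i
    using prime[OF that] prime_gt_0_nat by simp
qed

lemma card_cyclic_pairs_lower_bound:
  fixes p l :: "'i \<Rightarrow> nat"
  defines "b \<equiv> \<lambda>i. p i ^ l i + (p i ^ l i - 1) * p i"
  assumes I: "finite I" and cop: "\<And>i j. \<lbrakk>i \<in> I; j \<in> I; i \<noteq> j\<rbrakk> \<Longrightarrow> coprime (p i ^ l i) (p j ^ l j)"
    and prime: "\<And>i. i \<in> I \<Longrightarrow> prime (p i)" and l: "\<And>i. i \<in> I \<Longrightarrow> 1 \<le> l i"
    and order: "order G = (\<Prod>i \<in> I. p i ^ l i)"
  shows "(\<Prod>i \<in> I. b i) \<le> card (cyclic_pairs G (carrier G))"
    and "card (cyclic_pairs G (carrier G)) = (\<Prod>i \<in> I. b i) \<longleftrightarrow>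
      carrier G \<subseteq> roots_of_one G (\<Prod>i \<in> I. p i)"
proof -
  let ?D = "\<lambda>i. card (cyclic_pairs G (roots_of_one G (p i ^ l i)))"
  have carrier: "carrier G = roots_of_one G (\<Prod>i \<in> I. p i ^ l i)"
    using pow_order_eq_1 order by (auto simp: roots_of_one_def)
  have D: "card (cyclic_pairs G (carrier G)) = (\<Prod>i \<in> I. ?D i)"
    unfolding carrier
    by (rule prod_coprime_multiplicative[OF I cop])
      (auto simp: card_cyclic_pairs_mult card_cyclic_pairs_one simp del: One_nat_def)
  have card: "card (roots_of_one G (p i ^ l i)) = p i ^ l i" if "i \<in> I" for i
    by (rule card_roots_of_one_prime_power[OF I cop prime order that])
  have le: "b i \<le> ?D i" if "i \<in> I" for i
    using card_cyclic_pairs_prime_power(1)[OF finite_carrier prime[OF that], of "l i"] card[OF that]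
    by (simp add: b_def)
  have iff: "?D i = b i \<longleftrightarrow> roots_of_one G (p i ^ l i) \<subseteq> roots_of_one G (p i)" if "i \<in> I" for i
    using card_cyclic_pairs_prime_power(2)[OF finite_carrier prime[OF that], of "l i"] card[OF that]
    by (simp add: b_def)
  have pos: "0 < b i" if "i \<in> I" for i
    using prime[OF that] prime_gt_0_nat by (simp add: b_def)
  show "(\<Prod>i \<in> I. b i) \<le> card (cyclic_pairs G (carrier G))"
    unfolding D using le by (intro prod_mono) auto
  have "card (cyclic_pairs G (carrier G)) = (\<Prod>i \<in> I. b i) \<longleftrightarrow> (\<forall>i \<in> I. ?D i = b i)"
    unfolding D
    using prod_eq_imp_factors_eq[where f = b and g = ?D and I = I] I le pos
    by (metis (mono_tags, lifting) prod.cong)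
  also have "\<dots> \<longleftrightarrow> (\<forall>i \<in> I. roots_of_one G (p i ^ l i) \<subseteq> roots_of_one G (p i))"
    using iff by blast
  also have "\<dots> \<longleftrightarrow> carrier G \<subseteq> roots_of_one G (\<Prod>i \<in> I. p i)"
    unfolding carrier
    by (intro roots_of_one_subset_prod_iff[symmetric] I cop) (use l in \<open>auto intro!: dvd_power simp: Suc_le_eq\<close>)
  finally show "card (cyclic_pairs G (carrier G)) = (\<Prod>i \<in> I. b i) \<longleftrightarrow>
      carrier G \<subseteq> roots_of_one G (\<Prod>i \<in> I. p i)" .
qed

end

section \<open>Maximal cyclic subgroups\<close>

lemma (in group) in_maximal_cyclic:
  assumes fin: "finite (carrier G)" and x: "x \<in> carrier G"
  obtains M where "M \<in> maximal_cyclic_subgroups G" "x \<in> M"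
proof -
  have "finite (cyclic_subgroups G)"
    using fin by (simp add: cyclic_subgroups_def)
  moreover have "generate G {x} \<in> cyclic_subgroups G"
    using x by (auto simp: cyclic_subgroups_def)
  ultimately obtain M where M: "M \<in> cyclic_subgroups G" "generate G {x} \<subseteq> M"
      "\<forall>C \<in> cyclic_subgroups G. M \<subseteq> C \<longrightarrow> M = C"
    using finite_has_maximal2 by metis
  have "x \<in> M" using M(2) generate.incl[of x "{x}"] by blast
  moreover have "M \<in> maximal_cyclic_subgroups G"
    using M(1,3) unfolding maximal_cyclic_subgroups_def by blast
  ultimately show thesis using that by blast
qed

context finite_coprime_commuting_group
begin

text \<open>Otherwise take \<open>u\<close> of order \<open>p\<close>, which exists by Sylow's theorem. It commutes with the generator
  \<open>z\<close> of \<open>M\<close>, and \<open>z \<otimes> u\<close> generates a cyclic subgroup that contains both \<open>z\<close> and \<open>u\<close>.\<close>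

lemma prime_dvd_card_maximal_cyclic:
  assumes M: "M \<in> maximal_cyclic_subgroups G" and p: "prime p" "p dvd order G"
  shows "p dvd card M"
proof (rule ccontr)
  assume not_dvd: "\<not> p dvd card M"
  obtain z where z: "z \<in> carrier G" "M = generate G {z}"
    using M by (auto simp: maximal_cyclic_subgroups_def cyclic_subgroups_def)
  have "p \<le> card (roots_of_one G p)"
    using prime_power_le_card_roots_of_one[OF finite_carrier p(1), of 1] p(2) by simp
  then have "1 < card (roots_of_one G p)"
    using prime_gt_1_nat[OF p(1)] by simp
  then have "\<not> roots_of_one G p \<subseteq> {\<one>}"
    using card_mono[of "{\<one>}" "roots_of_one G p"] by auto
  then obtain u where u: "u \<in> roots_of_one G p" "u \<noteq> \<one>" by blast
  then have uC: "u \<in> carrier G" by (simp add: roots_of_one_def)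
  have cop: "coprime (card M) p"
    using not_dvd p(1) prime_imp_coprime coprime_commute by blast
  have zm: "z \<in> roots_of_one G (card M)"
    using z pow_ord_eq_1[OF z(1)] generate_pow_card[OF z(1)] by (simp add: roots_of_one_def)
  let ?w = "z \<otimes> u"
  have w: "?w \<in> carrier G" using z uC by simp
  obtain s t :: nat where st: "?w [^] s = z" "?w [^] t = u"
    by (rule coprime_projections[OF cop]) (use zm u in blast)
  have "M \<subseteq> generate G {?w}" "u \<in> generate G {?w}"
    using generate_pow_subset[OF finite_carrier w, of s] st z
      generate_pow_subset[OF finite_carrier w, of t] generate.incl[of u "{u}"] by auto
  moreover have "u \<notin> M"
  proof
    assume "u \<in> M"
    then have "u \<in> roots_of_one G (card M)"
      using generate_roots_of_one[OF finite_carrier zm] z by blast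
    then have "ord u dvd card M" "ord u dvd p"
      using u by (auto simp: roots_of_one_def pow_eq_id)
    then have "ord u = 1" using cop by (metis coprime_common_divisor_nat)
    then show False using u(2) uC ord_eq_1 by simp
  qed
  ultimately have "M \<subset> generate G {?w}" by blast
  moreover have "generate G {?w} \<in> cyclic_subgroups G"
    using w by (auto simp: cyclic_subgroups_def)
  ultimately show False
    using M by (auto simp: maximal_cyclic_subgroups_def)
qed

text \<open>The order of \<open>M\<close> is divisible by each prime in \<open>P\<close>, hence by their product; it divides the product
  when the exponent of the group does. Conversely every element lies in some maximal cyclic
  subgroup, whose order annihilates it.\<close>

lemma maximal_cyclic_card_iff:
  assumes P: "finite P" "\<And>p. p \<in> P \<Longrightarrow> prime p \<and> p dvd order G"
  shows "(\<forall>M \<in> maximal_cyclic_subgroups G. card M = \<Prod>P) \<longleftrightarrow> carrier G \<subseteq> roots_of_one G (\<Prod>P)"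
proof
  assume card: "\<forall>M \<in> maximal_cyclic_subgroups G. card M = \<Prod>P"
  show "carrier G \<subseteq> roots_of_one G (\<Prod>P)"
  proof
    fix x assume "x \<in> carrier G"
    then obtain M where M: "M \<in> maximal_cyclic_subgroups G" "x \<in> M"
      by (rule in_maximal_cyclic[OF finite_carrier])
    then obtain z where z: "z \<in> carrier G" "M = generate G {z}"
      by (auto simp: maximal_cyclic_subgroups_def cyclic_subgroups_def)
    then have "z \<in> roots_of_one G (\<Prod>P)"
      using card M generate_pow_card pow_ord_eq_1 by (metis (mono_tags, lifting) mem_Collect_eq roots_of_one_def)
    then show "x \<in> roots_of_one G (\<Prod>P)"
      using generate_roots_of_one[OF finite_carrier] z M by blast
  qed
next
  assume sub: "carrier G \<subseteq> roots_of_one G (\<Prod>P)"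
  show "\<forall>M \<in> maximal_cyclic_subgroups G. card M = \<Prod>P"
  proof
    fix M assume M: "M \<in> maximal_cyclic_subgroups G"
    then obtain z where z: "z \<in> carrier G" "M = generate G {z}"
      by (auto simp: maximal_cyclic_subgroups_def cyclic_subgroups_def)
    show "card M = \<Prod>P"
    proof (rule dvd_antisym)
      show "card M dvd \<Prod>P"
        using z sub generate_pow_card by (auto simp: roots_of_one_def pow_eq_id)
      have "(\<Prod>p \<in> Q. p) dvd card M" if "Q \<subseteq> P" for Q
        using finite_subset[OF that P(1)] that
      proof (induction Q rule: finite_induct)
        case (insert p Q)
        have "coprime p (\<Prod>p \<in> Q. p)"
          using insert P(2) by (intro prod_coprime_right) (auto intro!: primes_coprime)
        moreover have "p dvd card M"
          using insert P(2) prime_dvd_card_maximal_cyclic[OF M] by auto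
        ultimately show ?case
          using insert by (simp add: divides_mult)
      qed simp
      then show "\<Prod>P dvd card M" by blast
    qed
  qed
qed

end

section \<open>The Wiener index\<close>

context group
begin

lemma cyclic_pairs_subset: "cyclic_pairs G (carrier G) \<subseteq> carrier G \<times> carrier G"
proof -
  have "generate G {z} \<subseteq> carrier G" if "z \<in> carrier G" for z
    using that by (intro generate_incl) auto
  then show ?thesis unfolding cyclic_pairs_def by blast
qed

lemma graph_dist_enhanced_power_graph:
  assumes xy: "x \<in> carrier G" "y \<in> carrier G"
  shows "graph_dist (with_proj (enhanced_power_graph G)) x y =
    (if x = y then 0 else if (x, y) \<in> cyclic_pairs G (carrier G) then 1 else 2)"
proof -
  let ?E = "with_proj (enhanced_power_graph G)"
  define P where "P k \<longleftrightarrow> (\<exists>w. pre_digraph.apath ?E x w y \<and> length w = k)" for k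
  note apath = pre_digraph.apath_def pre_digraph.awalk_def pre_digraph.cas.simps
    pre_digraph.awalk_verts.simps
  have arc: "(u, v) \<in> parcs (enhanced_power_graph G) \<longleftrightarrow>
      u \<noteq> v \<and> (u, v) \<in> cyclic_pairs G (carrier G)" for u v
  proof -
    have "u \<in> carrier G \<and> v \<in> carrier G" if "(u, v) \<in> cyclic_pairs G (carrier G)"
      using that cyclic_pairs_subset by blast
    moreover have "(u, v) \<in> cyclic_pairs G (carrier G) \<longleftrightarrow>
        (\<exists>z \<in> carrier G. u \<in> generate G {z} \<and> v \<in> generate G {z})"
      unfolding cyclic_pairs_def by blast
    ultimately show ?thesis
      unfolding enhanced_power_graph_def by force
  qed
  have verts: "verts ?E = carrier G" by (simp add: enhanced_power_graph_def)
  have one: "(u, \<one>) \<in> cyclic_pairs G (carrier G)" "(\<one>, u) \<in> cyclic_pairs G (carrier G)"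
    if "u \<in> carrier G" for u
    using that by (auto simp: cyclic_pairs_def intro: generate.intros)
  have path0: "P 0 \<longleftrightarrow> x = y"
    using xy verts by (auto simp: P_def apath)
  have path1: "P 1 \<longleftrightarrow> x \<noteq> y \<and> (x, y) \<in> cyclic_pairs G (carrier G)"
  proof
    assume "P 1"
    then obtain e where "pre_digraph.apath ?E x [e] y"
      by (auto simp: P_def length_Suc_conv)
    then show "x \<noteq> y \<and> (x, y) \<in> cyclic_pairs G (carrier G)"
      using arc by (cases e) (auto simp: apath)
  next
    assume "x \<noteq> y \<and> (x, y) \<in> cyclic_pairs G (carrier G)"
    then have "pre_digraph.apath ?E x [(x, y)] y"
      using arc[of x y] xy verts by (auto simp: apath)
    then show "P 1" unfolding P_def by force
  qed
  \<comment> \<open>The detour through the identity.\<close>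
  have path2: "P 2" if "x \<noteq> y" "(x, y) \<notin> cyclic_pairs G (carrier G)"
  proof -
    have "x \<noteq> \<one>" "y \<noteq> \<one>" using that one xy by auto
    then have "pre_digraph.apath ?E x [(x, \<one>), (\<one>, y)] y"
      using arc[of x \<one>] arc[of \<one> y] one xy verts that by (auto simp: apath)
    then show ?thesis unfolding P_def by force
  qed
  show ?thesis
    unfolding graph_dist_def P_def[symmetric]
  proof (rule Least_equality)
    show "P (if x = y then 0 else if (x, y) \<in> cyclic_pairs G (carrier G) then 1 else 2)"
      using path0 path1 path2 by simp
    fix k assume "P k"
    moreover have "k = 0 \<or> k = 1 \<or> 2 \<le> k" by linarith
    ultimately show "(if x = y then 0 else if (x, y) \<in> cyclic_pairs G (carrier G) then 1 else 2) \<le> k"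
      using path0 path1 by auto
  qed
qed

lemma wiener_index_enhanced_power_graph:
  assumes fin: "finite (carrier G)"
  shows "wiener_index (with_proj (enhanced_power_graph G)) =
    (2 * real (order G) ^ 2 - real (order G) - real (card (cyclic_pairs G (carrier G)))) / 2"
proof -
  let ?V = "carrier G" and ?D = "cyclic_pairs G (carrier G)"
  let ?ind = "\<lambda>b. if b then 1 else 0 :: real"
  note D = cyclic_pairs_subset
  have refl: "(x, x) \<in> ?D" if "x \<in> ?V" for x
    using that by (auto simp: cyclic_pairs_def intro: generate.incl)
  \<comment> \<open>Since \<open>D\<close> contains the diagonal, the three possible distances fit one linear formula.\<close>
  have dist: "real (graph_dist (with_proj (enhanced_power_graph G)) x y) / 2 =
      1 - ?ind (x = y) / 2 - ?ind ((x, y) \<in> ?D) / 2" if "x \<in> ?V" "y \<in> ?V" for x y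
    using graph_dist_enhanced_power_graph[OF that] refl[OF that(1)] by auto
  have "wiener_index (with_proj (enhanced_power_graph G)) =
      (\<Sum>x \<in> ?V. \<Sum>y \<in> ?V. 1 - ?ind (x = y) / 2 - ?ind ((x, y) \<in> ?D) / 2)"
    unfolding wiener_index_def using dist
    by (intro sum.cong) (simp_all add: enhanced_power_graph_def)
  also have "\<dots> = (\<Sum>x \<in> ?V. \<Sum>y \<in> ?V. 1) - (\<Sum>x \<in> ?V. \<Sum>y \<in> ?V. ?ind (x = y)) / 2
      - (\<Sum>x \<in> ?V. \<Sum>y \<in> ?V. ?ind ((x, y) \<in> ?D)) / 2"
    by (simp only: sum_subtractf sum_divide_distrib)
  also have "(\<Sum>x \<in> ?V. \<Sum>y \<in> ?V. ?ind (x = y)) = real (order G)"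
    using fin by (simp add: order_def)
  also have "(\<Sum>x \<in> ?V. \<Sum>y \<in> ?V. ?ind ((x, y) \<in> ?D)) = (\<Sum>q \<in> ?V \<times> ?V. ?ind (q \<in> ?D))"
    by (simp add: sum.cartesian_product case_prod_beta)
  also have "\<dots> = real (card ((?V \<times> ?V) \<inter> ?D))"
    using fin by (simp flip: sum.inter_restrict)
  also have "(?V \<times> ?V) \<inter> ?D = ?D" using D by blast
  finally show ?thesis
    by (simp add: order_def power2_eq_square diff_divide_distrib)
qed

lemma card_cyclic_pairs_upper_bound:
  assumes fin: "finite (carrier G)"
  shows "card (cyclic_pairs G (carrier G)) \<le> order G ^ 2"
    and "card (cyclic_pairs G (carrier G)) = order G ^ 2 \<longleftrightarrow> cyclic_group G"
proof -
  let ?V = "carrier G" and ?D = "cyclic_pairs G (carrier G)"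
  note D = cyclic_pairs_subset
  have V: "finite (?V \<times> ?V)" "card (?V \<times> ?V) = order G ^ 2"
    using fin by (auto simp: order_def power2_eq_square card_cartesian_product)
  show "card ?D \<le> order G ^ 2" using card_mono[OF V(1) D] V(2) by simp
  have cyclic: "cyclic_group G \<longleftrightarrow> (\<exists>z \<in> ?V. generate G {z} = ?V)"
  proof -
    have "range (\<lambda>k::int. z [^] k) = generate G {z}" if "z \<in> ?V" for z
      using generate_pow[OF that] by auto
    then show ?thesis by (auto simp: cyclic_group)
  qed
  have "?D = ?V \<times> ?V \<longleftrightarrow> cyclic_group G"
  proof
    assume eq: "?D = ?V \<times> ?V"
    \<comment> \<open>A cyclic subgroup containing \<open>z\<close> and \<open>x\<close> cannot exceed the maximal one generated by \<open>z\<close>.\<close>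
    obtain M where "M \<in> maximal_cyclic_subgroups G"
      by (rule in_maximal_cyclic[OF fin one_closed])
    then obtain z where z: "z \<in> ?V"
      and max: "\<And>w. w \<in> ?V \<Longrightarrow> \<not> generate G {z} \<subset> generate G {w}"
      unfolding maximal_cyclic_subgroups_def cyclic_subgroups_def by blast
    have "x \<in> generate G {z}" if "x \<in> ?V" for x
    proof -
      have "(x, z) \<in> ?D" using eq that z by blast
      then obtain w where w: "w \<in> ?V" "x \<in> generate G {w}" "z \<in> generate G {w}"
        by (auto simp: cyclic_pairs_def)
      then have "generate G {z} = generate G {w}"
        using generate_singleton_mono[OF fin w(1,3)] max[OF w(1)] by blast
      then show ?thesis using w(2) by simp
    qed
    then have "generate G {z} = ?V" using z generate_incl[of "{z}"] by blast
    then show "cyclic_group G" using cyclic z by blast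
  next
    assume "cyclic_group G"
    then obtain z where z: "z \<in> ?V" "generate G {z} = ?V" using cyclic by blast
    have "generate G {z} \<times> generate G {z} \<subseteq> ?D"
      using z(1) unfolding cyclic_pairs_def by blast
    then have "?V \<times> ?V \<subseteq> ?D" unfolding z(2) .
    then show "?D = ?V \<times> ?V" using D by blast
  qed
  then show "card ?D = order G ^ 2 \<longleftrightarrow> cyclic_group G"
    using card_subset_eq[OF V(1) D] V(2) by metis
qed

end

theorem theorem6p5:
  fixes G :: "('a, 'b) monoid_scheme"
    and n r :: nat
    and p l :: "nat \<Rightarrow> nat"
  assumes "finite (carrier G)"
    and "nilpotent_group G"
    and "order G = n"
    and "n = (\<Prod>i = 1..r. p i ^ l i)"
    and "\<And>i. i \<in> {1..r} \<Longrightarrow> prime (p i)"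
    and "strict_mono_on {1..r} p"
    and "\<And>i. i \<in> {1..r} \<Longrightarrow> l i \<ge> 1"
  shows
    "real n * (real n - 1) / 2 \<le> wiener_index (with_proj (enhanced_power_graph G))
     \<and> wiener_index (with_proj (enhanced_power_graph G))
         \<le> (2 * real n ^ 2 - real n
             - (\<Prod>i = 1..r. (real (p i) ^ (l i + 1) + real (p i) ^ l i - real (p i)))) / 2
     \<and> (wiener_index (with_proj (enhanced_power_graph G)) = real n * (real n - 1) / 2
         \<longleftrightarrow> cyclic_group G)
     \<and> (wiener_index (with_proj (enhanced_power_graph G))
           = (2 * real n ^ 2 - real n
               - (\<Prod>i = 1..r. (real (p i) ^ (l i + 1) + real (p i) ^ l i - real (p i)))) / 2
         \<longleftrightarrow> (\<forall>M \<in> maximal_cyclic_subgroups G. card M = (\<Prod>i = 1..r. p i)))"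
proof -
  interpret finite_coprime_commuting_group G
  proof (intro finite_coprime_commuting_group.intro finite_coprime_commuting_group_axioms.intro)
    show "group G" using assms(2) by (simp add: nilpotent_group_def)
  qed (use assms(1) nilpotent_coprime_commute[OF assms(2)] in blast)+
  let ?I = "{1..r}" and ?D = "card (cyclic_pairs G (carrier G))"
  let ?W = "wiener_index (with_proj (enhanced_power_graph G))"
  let ?B = "\<Prod>i = 1..r. p i ^ l i + (p i ^ l i - 1) * p i"
  let ?R = "\<Prod>i = 1..r. (real (p i) ^ (l i + 1) + real (p i) ^ l i - real (p i))"
  have W: "?W = (2 * real n ^ 2 - real n - real ?D) / 2"
    using wiener_index_enhanced_power_graph[OF assms(1)] assms(3) by simp
  have inj: "inj_on p ?I" using assms(6) strict_mono_on_imp_inj_on by blast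
  have cop: "coprime (p i ^ l i) (p j ^ l j)" if "i \<in> ?I" "j \<in> ?I" "i \<noteq> j" for i j
    using that inj assms(5) by (auto intro!: primes_coprime dest: inj_onD)
  have order: "order G = (\<Prod>i \<in> ?I. p i ^ l i)" using assms(3,4) by simp
  have B: "?R = real ?B"
    unfolding of_nat_prod
  proof (rule prod.cong[OF refl])
    fix i assume "i \<in> ?I"
    then have "1 \<le> p i ^ l i" using assms(5) prime_gt_0_nat[of "p i"] by simp
    then have "real (p i ^ l i - 1) = real (p i) ^ l i - 1" by (simp add: of_nat_diff)
    then show "real (p i) ^ (l i + 1) + real (p i) ^ l i - real (p i) =
        real (p i ^ l i + (p i ^ l i - 1) * p i)"
      by (simp only: of_nat_add of_nat_mult of_nat_power) (simp add: algebra_simps)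
  qed
  have "?B \<le> ?D" and low: "?D = ?B \<longleftrightarrow> carrier G \<subseteq> roots_of_one G (\<Prod>i \<in> ?I. p i)"
    using card_cyclic_pairs_lower_bound[of ?I p l, OF finite_atLeastAtMost cop assms(5,7) order]
    by simp_all
  have dvd: "p i dvd order G" if "i \<in> ?I" for i
  proof -
    have "p i dvd p i ^ l i" using assms(7)[OF that] by (simp add: dvd_power)
    also have "\<dots> dvd order G" unfolding order using that by (intro dvd_prodI) auto
    finally show ?thesis .
  qed
  have "\<Prod>(p ` ?I) = (\<Prod>i \<in> ?I. p i)"
    using inj by (simp add: prod.reindex)
  moreover have "prime q \<and> q dvd order G" if "q \<in> p ` ?I" for q
    using that assms(5) dvd by blast
  ultimately have max: "(\<forall>M \<in> maximal_cyclic_subgroups G. card M = (\<Prod>i \<in> ?I. p i)) \<longleftrightarrow>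
      carrier G \<subseteq> roots_of_one G (\<Prod>i \<in> ?I. p i)"
    using maximal_cyclic_card_iff[of "p ` ?I"] by (metis finite_atLeastAtMost finite_imageI)
  have up: "?D \<le> n ^ 2" "?D = n ^ 2 \<longleftrightarrow> cyclic_group G"
    using card_cyclic_pairs_upper_bound[OF assms(1)] assms(3) by auto
  have "real ?D \<le> real n ^ 2" "real ?D = real n ^ 2 \<longleftrightarrow> cyclic_group G"
    using up by (simp_all flip: of_nat_power)
  moreover have "?R \<le> real ?D" "?R = real ?D \<longleftrightarrow>
      (\<forall>M \<in> maximal_cyclic_subgroups G. card M = (\<Prod>i = 1..r. p i))"
    using \<open>?B \<le> ?D\<close> low max by (auto simp only: B of_nat_le_iff of_nat_eq_iff)
  moreover have "real n * (real n - 1) / 2 = (2 * real n ^ 2 - real n - real n ^ 2) / 2"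
    by (simp add: power2_eq_square algebra_simps)
  ultimately show ?thesis
    unfolding W by auto
qed

end
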